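(* Let $T=(V,E)$ be a finite tree with at least one edge, let $p\in(0,1)$ and let $q\ge1$ be a natural number. Let $P_{\rm SW}$ be the transition matrix of the Swendsen-Wang dynamics for the random-cluster model on $T$ with parameters $p$ and $q$. Then $$\lambda(P_{\rm SW})^{-1}\;\le\;2\bigl(1-p(1-q^{-1})\bigr)^{-1}\,|E|,$$ where $\lambda(\cdot)$ denotes the spectral gap.
   Context: The random-cluster model on a finite graph $G=(V,E)$ with parameters $p,q$ has state space $\Omega_{\rm RC}=\{A: A\subseteq E\}$ and probability measure $\mu(A)=\frac1Z\left(\frac{p}{1-p}\right)^{|A|}q^{c(A)}$, where $c(A)$ is the number of connected components of $(V,A)$ (isolated vertices count as components) and $Z$ is the normalizing constant. Let $\Omega_{\rm P}=\{1,\dots,q\}^V$. For $A\subseteq E$ let $\Omega(A)=\{\sigma\in\Omega_{\rm P}:\sigma(u)=\sigma(v)\text{ for all }\{u,v\}\in A\}$, and for $\sigma\in\Omega_{\rm P}$ let $E(\sigma)=\{\{u,v\}\in E:\sigma(u)=\sigma(v)\}$. Write $\mathbf 1(\cdot)$ for the indicator. Swendsen-Wang dynamics (on $\Omega_{\rm RC}$): for $A,B\subseteq E$, $$P_{\rm SW}(A,B)=q^{-c(A)}\left(\frac{p}{1-p}\right)^{|B|}\sum_{\sigma\in\Omega_{\rm P}}(1-p)^{|E(\sigma)|}\,\mathbf 1\bigl(\sigma\in\Omega(A\cup B)\bigr).$$ That is: given $A$, color each connected component of $(V,A)$ independently and uniformly with a color in $\{1,\dots,q\}$, obtaining $\sigma$;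 then keep each edge of $E(\sigma)$ independently with probability $p$ to obtain $B$. This chain is ergodic and reversible with respect to $\mu$. The spectral gap of an ergodic reversible transition matrix $P$ is $\lambda(P)=1-\max\{|\xi|:\xi\text{ is an eigenvalue of }P,\ \xi\ne1\}$. *)

theory Defs
  imports Complex_Main "HOL-Library.FuncSet"
begin

definition simple_graph :: "'v set \<Rightarrow> 'v set set \<Rightarrow> bool" where
  "simple_graph V E \<longleftrightarrow> finite V \<and> (\<forall>e\<in>E. e \<subseteq> V \<and> card e = 2)"

definition connected_rel :: "'v set \<Rightarrow> 'v set set \<Rightarrow> ('v \<times> 'v) set" where
  "connected_rel V A = {(u, v) \<in> V \<times> V. (u, v) \<in> {(x, y). {x, y} \<in> A}\<^sup>*}"

definition num_components :: "'v set \<Rightarrow> 'v set set \<Rightarrow> nat" where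
  "num_components V A = card (V // connected_rel V A)"

text \<open>A cycle is given by its vertices in cyclic order; the closing edge is the one with
  \<open>Suc i = length xs\<close>.\<close>

definition is_cycle :: "'v set set \<Rightarrow> 'v list \<Rightarrow> bool" where
  "is_cycle E xs \<longleftrightarrow> length xs \<ge> 3 \<and> distinct xs \<and>
     (\<forall>i<length xs. {xs ! i, xs ! (Suc i mod length xs)} \<in> E)"

definition finite_tree :: "'v set \<Rightarrow> 'v set set \<Rightarrow> bool" where
  "finite_tree V E \<longleftrightarrow> simple_graph V E \<and> V \<noteq> {} \<and> connected_rel V E = V \<times> V \<and>
     (\<nexists>xs. is_cycle E xs)"

text \<open>Colourings are extensional functions, so that there are exactly \<open>q ^ card V\<close> of them.\<close>

definition colourings :: "'v set \<Rightarrow> nat \<Rightarrow> ('v \<Rightarrow> nat) set" where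
  "colourings V q = V \<rightarrow>\<^sub>E {1..q}"

definition compatible_colourings :: "'v set \<Rightarrow> nat \<Rightarrow> 'v set set \<Rightarrow> ('v \<Rightarrow> nat) set" where
  "compatible_colourings V q A =
     {\<sigma> \<in> colourings V q. \<forall>u v. {u, v} \<in> A \<longrightarrow> \<sigma> u = \<sigma> v}"

definition mono_edges :: "'v set set \<Rightarrow> ('v \<Rightarrow> nat) \<Rightarrow> 'v set set" where
  "mono_edges E \<sigma> = {e \<in> E. \<exists>u v. e = {u, v} \<and> \<sigma> u = \<sigma> v}"

text \<open>Swendsen--Wang transition probabilities; the state space is \<open>Pow E\<close>, and the values
  are only meaningful for \<open>A, B \<subseteq> E\<close>.\<close>

definition P_SW ::
  "'v set \<Rightarrow> 'v set set \<Rightarrow> real \<Rightarrow> nat \<Rightarrow> 'v set set \<Rightarrow> 'v set set \<Rightarrow> real" where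
  "P_SW V E p q A B =
     inverse (real q ^ num_components V A) * (p / (1 - p)) ^ card B *
     (\<Sum>\<sigma>\<in>colourings V q. (1 - p) ^ card (mono_edges E \<sigma>) *
        of_bool (\<sigma> \<in> compatible_colourings V q (A \<union> B)))"

text \<open>Matrices indexed by a finite set \<open>S\<close> are functions of two arguments, of which only the
  values on \<open>S\<close> matter. Eigenvalues are taken over the complex numbers.\<close>

definition eigenvalue_on :: "'s set \<Rightarrow> ('s \<Rightarrow> 's \<Rightarrow> real) \<Rightarrow> complex \<Rightarrow> bool" where
  "eigenvalue_on S P \<xi> \<longleftrightarrow>
     (\<exists>f :: 's \<Rightarrow> complex. (\<exists>x\<in>S. f x \<noteq> 0) \<and>
        (\<forall>x\<in>S. (\<Sum>y\<in>S. complex_of_real (P x y) * f y) = \<xi> * f x))"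

definition spectral_gap :: "'s set \<Rightarrow> ('s \<Rightarrow> 's \<Rightarrow> real) \<Rightarrow> real" where
  "spectral_gap S P = 1 - Max {cmod \<xi> | \<xi>. eigenvalue_on S P \<xi> \<and> \<xi> \<noteq> 1}"

end

theory Submission imports Defs "HOL-Combinatorics.Transposition" begin

text \<open>
  On a forest the Swendsen--Wang chain is a product of independent two-state chains, one for
  each edge. Indeed, given \<open>A\<close>, an edge of \<open>A\<close> is always monochromatic, while the edges outside
  \<open>A\<close> are monochromatic independently with probability \<open>1 / q\<close>, because there is no cycle to
  correlate the colour differences along them. Hence an edge of \<open>A\<close> survives with probability
  \<open>p\<close>, and any other edge appears with probability \<open>p / q\<close>, independently of each other
  (lemma \<open>P_SW_forest\<close>).

  The two-state chain of an edge has the eigenvalues \<open>1\<close> and \<open>b = p - p / q = p * (1 - 1 / q)\<close>.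
  Products of its left eigenvectors diagonalise the whole chain, whose eigenvalues are
  therefore powers of \<open>b\<close>, with \<open>b\<close> itself among them as soon as there is an edge. The
  spectral gap is then exactly \<open>1 - p * (1 - 1 / q)\<close> (lemma \<open>spectral_gap_product\<close>), and the
  claimed bound holds with the factor \<open>2 * card E\<close> to spare.

  The independence of the edges is the factorisation \<open>sum_colourings_forest\<close>, proved by adding
  the edges one at a time: recolouring the component of one end of the new edge changes
  nothing on the old edges, and makes the colour of that end uniform.
\<close>

section \<open>Paths and cycles\<close>

abbreviation adjacent :: "'v set set \<Rightarrow> ('v \<times> 'v) set" where
  "adjacent A \<equiv> {(x, y). {x, y} \<in> A}"

lemma rtrancl_adjacent_sym: "(u, v) \<in> (adjacent A)\<^sup>* \<Longrightarrow> (v, u) \<in> (adjacent A)\<^sup>*"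
  by (rule symD[OF sym_rtrancl]) (auto simp: sym_def insert_commute)

lemma rtrancl_adjacent_imp_simple_path:
  assumes "(u, v) \<in> (adjacent A)\<^sup>*"
  shows "\<exists>xs. xs \<noteq> [] \<and> hd xs = u \<and> last xs = v \<and> distinct xs \<and>
           (\<forall>i. Suc i < length xs \<longrightarrow> {xs ! i, xs ! Suc i} \<in> A)"
  using assms
proof (induction rule: rtrancl_induct)
  case base
  show ?case by (rule exI[of _ "[u]"]) auto
next
  case (step w z)
  then obtain xs where xs: "xs \<noteq> []" "hd xs = u" "last xs = w" "distinct xs"
    "\<And>i. Suc i < length xs \<Longrightarrow> {xs ! i, xs ! Suc i} \<in> A" by blast
  show ?case
  proof (cases "z \<in> set xs")
    case True
    then obtain j where j: "j < length xs" "xs ! j = z" by (auto simp: in_set_conv_nth)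
    then have "last (take (Suc j) xs) = z"
      by (simp add: take_Suc_conv_app_nth)
    with xs j show ?thesis
      by (intro exI[of _ "take (Suc j) xs"]) auto
  next
    case False
    have "{(xs @ [z]) ! i, (xs @ [z]) ! Suc i} \<in> A" if "Suc i < length (xs @ [z])" for i
    proof (cases "Suc i < length xs")
      case True
      then show ?thesis using xs(5)[of i] by (simp add: nth_append)
    next
      case False
      then have i: "i = length xs - 1" "Suc i = length xs" using that xs(1) by auto
      then have "xs ! i = w" using xs(1,3) by (simp add: last_conv_nth)
      then show ?thesis using i(2) step.hyps(2)
        by (metis (no_types, lifting) case_prodD lessI mem_Collect_eq nth_append
            nth_append_length)
    qed
    with xs False show ?thesis
      by (intro exI[of _ "xs @ [z]"]) auto
  qed
qed

lemma acyclic_edge_separates: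
  assumes acyclic: "\<nexists>xs. is_cycle E xs"
    and "A \<subseteq> E" "{u, v} \<in> E" "{u, v} \<notin> A" "u \<noteq> v"
  shows "(u, v) \<notin> (adjacent A)\<^sup>*"
proof
  assume "(u, v) \<in> (adjacent A)\<^sup>*"
  from rtrancl_adjacent_imp_simple_path[OF this]
  obtain xs where xs: "xs \<noteq> []" "hd xs = u" "last xs = v" "distinct xs"
    "\<And>i. Suc i < length xs \<Longrightarrow> {xs ! i, xs ! Suc i} \<in> A" by blast
  have ends: "xs ! 0 = u" "xs ! (length xs - 1) = v"
    using xs by (auto simp: hd_conv_nth last_conv_nth)
  have "length xs \<noteq> 0" "length xs \<noteq> 1" "length xs \<noteq> 2"
    using ends xs(1) assms(4,5) xs(5)[of 0] by auto
  then have len: "length xs \<ge> 3" by linarith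
  have "{xs ! i, xs ! (Suc i mod length xs)} \<in> E" if "i < length xs" for i
  proof (cases "Suc i < length xs")
    case True
    then show ?thesis using xs(5)[of i] assms(2) by auto
  next
    case False
    then have "Suc i = length xs" "i = length xs - 1" using that by auto
    then show ?thesis using ends assms(3) by (simp add: insert_commute)
  qed
  with len xs(4) have "is_cycle E xs" by (auto simp: is_cycle_def)
  with acyclic show False by blast
qed

section \<open>Colourings of a forest\<close>

definition monochromatic :: "'v set \<Rightarrow> ('v \<Rightarrow> nat) \<Rightarrow> bool" where
  "monochromatic e \<sigma> \<longleftrightarrow> (\<exists>u v. e = {u, v} \<and> \<sigma> u = \<sigma> v)"

lemma monochromatic_insert [simp]: "monochromatic {u, v} \<sigma> \<longleftrightarrow> \<sigma> u = \<sigma> v"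
  by (auto simp: monochromatic_def doubleton_eq_iff)

lemma finite_colourings: "finite V \<Longrightarrow> finite (colourings V q)"
  by (simp add: colourings_def finite_PiE)

lemma card_colourings: "finite V \<Longrightarrow> card (colourings V q) = q ^ card V"
  by (simp add: colourings_def card_PiE)

lemma simple_graph_finite_edges: "simple_graph V E \<Longrightarrow> finite E"
  unfolding simple_graph_def by (metis PowI finite_Pow_iff finite_subset subsetI)

lemma simple_graph_edgeE:
  assumes "simple_graph V E" "e \<in> E"
  obtains u v where "e = {u, v}" "u \<noteq> v" "u \<in> V" "v \<in> V"
  using assms unfolding simple_graph_def card_2_iff by force

text \<open>The resampling step: a new edge between two components of a graph is monochromatic
  with probability \<open>1 / q\<close> independently of the old edges. Exchanging the colour of \<open>u\<close> with a
  further colour \<open>k\<close> throughout the component of \<open>u\<close> is an involution on the pairs of a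
  colouring and a colour; it does not change which old edges are monochromatic, and turns the
  new edge into the comparison of \<open>k\<close> with the colour of \<open>v\<close>.\<close>

lemma sum_colourings_insert_edge:
  fixes g :: "'v set \<Rightarrow> bool \<Rightarrow> real" and h :: "bool \<Rightarrow> real"
  assumes graph: "simple_graph V A"
    and uv: "u \<in> V" "v \<in> V" "(u, v) \<notin> (adjacent A)\<^sup>*"
  shows "(\<Sum>\<sigma>\<in>colourings V q. (\<Prod>e\<in>A. g e (monochromatic e \<sigma>)) * h (\<sigma> u = \<sigma> v)) * real q =
         (\<Sum>\<sigma>\<in>colourings V q. \<Prod>e\<in>A. g e (monochromatic e \<sigma>)) *
           (h True + (real q - 1) * h False)"
proof -
  define F where "F \<sigma> = (\<Prod>e\<in>A. g e (monochromatic e \<sigma>))" for \<sigma>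
  define C where "C = {w. (u, w) \<in> (adjacent A)\<^sup>*}"
  define \<phi> :: "('v \<Rightarrow> nat) \<Rightarrow> nat \<Rightarrow> 'v \<Rightarrow> nat"
    where "\<phi> \<sigma> k = (\<lambda>w. if w \<in> C \<inter> V then transpose (\<sigma> u) k (\<sigma> w) else \<sigma> w)" for \<sigma> k
  define \<Phi> where "\<Phi> = (\<lambda>(\<sigma>, k). (\<phi> \<sigma> k, \<sigma> u))"
  have uC: "u \<in> C \<inter> V" and vC: "v \<notin> C \<inter> V" using uv by (auto simp: C_def)
  have \<phi>u: "\<phi> \<sigma> k u = k" and \<phi>v: "\<phi> \<sigma> k v = \<sigma> v" for \<sigma> k
    using uC vC by (auto simp: \<phi>_def)
  have F_inv: "F (\<phi> \<sigma> k) = F \<sigma>" for \<sigma> k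
    unfolding F_def
  proof (rule prod.cong[OF refl])
    fix e assume e: "e \<in> A"
    obtain a b where ab: "e = {a, b}" "a \<in> V" "b \<in> V"
      using simple_graph_edgeE[OF graph e] by metis
    have "(a, b) \<in> adjacent A" "(b, a) \<in> adjacent A"
      using e ab by (auto simp: insert_commute)
    then have "a \<in> C \<longleftrightarrow> b \<in> C"
      unfolding C_def by (auto intro: rtrancl_into_rtrancl)
    then show "g e (monochromatic e (\<phi> \<sigma> k)) = g e (monochromatic e \<sigma>)"
      using ab by (auto simp: \<phi>_def inj_eq[OF inj_transpose])
  qed
  have mem: "\<Phi> x \<in> colourings V q \<times> {1..q}" if "x \<in> colourings V q \<times> {1..q}" for x
  proof -
    obtain \<sigma> k where x: "x = (\<sigma>, k)" by force
    have \<sigma>: "\<sigma> w \<in> {1..q}" if "w \<in> V" for w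
      using \<open>x \<in> _\<close> that x by (auto simp: colourings_def PiE_iff)
    then show ?thesis
      using \<open>x \<in> _\<close> x uv(1) \<sigma>[OF uv(1)]
      by (auto simp: \<Phi>_def \<phi>_def colourings_def PiE_iff extensional_def transpose_def)
  qed
  have invol: "\<Phi> (\<Phi> x) = x" for x
  proof -
    obtain \<sigma> k where x: "x = (\<sigma>, k)" by force
    have "\<phi> (\<phi> \<sigma> k) (\<sigma> u) = \<sigma>"
      using \<phi>u[of \<sigma> k]
      by (subst \<phi>_def) (auto simp: fun_eq_iff \<phi>_def transpose_commute[of k])
    then show ?thesis by (simp add: x \<Phi>_def \<phi>u)
  qed
  have "(\<Sum>\<sigma>\<in>colourings V q. F \<sigma> * h (\<sigma> u = \<sigma> v)) * real q
      = (\<Sum>(\<sigma>, k)\<in>colourings V q \<times> {1..q}. F \<sigma> * h (\<sigma> u = \<sigma> v))"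
    by (simp add: sum.cartesian_product[symmetric] sum_distrib_left mult.commute)
  also have "\<dots> = (\<Sum>(\<sigma>, k)\<in>colourings V q \<times> {1..q}. F \<sigma> * h (k = \<sigma> v))"
    by (rule sum.reindex_bij_witness[of _ \<Phi> \<Phi>])
      (use mem invol in \<open>auto simp: \<Phi>_def F_inv \<phi>u \<phi>v\<close>)
  also have "\<dots> = (\<Sum>\<sigma>\<in>colourings V q. F \<sigma> * (\<Sum>k\<in>{1..q}. h (k = \<sigma> v)))"
    by (simp add: sum.cartesian_product[symmetric] sum_distrib_left)
  also have "\<dots> = (\<Sum>\<sigma>\<in>colourings V q. F \<sigma> * (h True + (real q - 1) * h False))"
  proof (rule sum.cong[OF refl])
    fix \<sigma> assume "\<sigma> \<in> colourings V q"
    then have v: "\<sigma> v \<in> {1..q}" using uv(2) by (auto simp: colourings_def PiE_iff)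
    have "(\<Sum>k\<in>{1..q}. h (k = \<sigma> v)) = h True + (\<Sum>k\<in>{1..q} - {\<sigma> v}. h (k = \<sigma> v))"
      using v by (subst sum.remove[of _ "\<sigma> v"]) auto
    also have "(\<Sum>k\<in>{1..q} - {\<sigma> v}. h (k = \<sigma> v)) = (\<Sum>k\<in>{1..q} - {\<sigma> v}. h False)"
      by (rule sum.cong) auto
    also have "\<dots> = (real q - 1) * h False"
      using v by (simp add: card_Diff_singleton of_nat_diff)
    finally show "F \<sigma> * (\<Sum>k\<in>{1..q}. h (k = \<sigma> v)) = F \<sigma> * (h True + (real q - 1) * h False)"
      by simp
  qed
  finally show ?thesis unfolding F_def by (simp add: sum_distrib_right)
qed

lemma sum_colourings_forest:
  fixes g :: "'v set \<Rightarrow> bool \<Rightarrow> real"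
  assumes graph: "simple_graph V E" and acyclic: "\<nexists>xs. is_cycle E xs"
  shows "(\<Sum>\<sigma>\<in>colourings V q. \<Prod>e\<in>E. g e (monochromatic e \<sigma>)) * real q ^ card E =
         real q ^ card V * (\<Prod>e\<in>E. g e True + (real q - 1) * g e False)"
proof -
  have "finite E" using graph by (rule simple_graph_finite_edges)
  have "(\<Sum>\<sigma>\<in>colourings V q. \<Prod>e\<in>A. g e (monochromatic e \<sigma>)) * real q ^ card A =
         real q ^ card V * (\<Prod>e\<in>A. g e True + (real q - 1) * g e False)"
    if "finite A" "A \<subseteq> E" for A
    using that
  proof (induction A rule: finite_induct)
    case empty
    then show ?case using graph by (simp add: card_colourings simple_graph_def)
  next
    case (insert e A)
    obtain u v where e: "e = {u, v}" "u \<noteq> v" "u \<in> V" "v \<in> V"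
      using simple_graph_edgeE[OF graph, of e] insert.prems by auto
    have sep: "(u, v) \<notin> (adjacent A)\<^sup>*"
      by (rule acyclic_edge_separates[OF acyclic]) (use insert e in auto)
    have A: "simple_graph V A" using graph insert.prems by (auto simp: simple_graph_def)
    let ?S = "\<Sum>\<sigma>\<in>colourings V q. \<Prod>e\<in>A. g e (monochromatic e \<sigma>)"
    have "(\<Sum>\<sigma>\<in>colourings V q. \<Prod>e\<in>insert e A. g e (monochromatic e \<sigma>)) * real q
        = ?S * (g e True + (real q - 1) * g e False)"
      using sum_colourings_insert_edge[OF A e(3,4) sep, where g = g and h = "g e" and q = q]
        insert.hyps by (simp add: e(1) mult.commute)
    moreover have "?S * real q ^ card A
        = real q ^ card V * (\<Prod>e\<in>A. g e True + (real q - 1) * g e False)"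
      using insert.IH insert.prems by simp
    moreover have "real q ^ card (insert e A) = real q * real q ^ card A"
      using insert.hyps by simp
    moreover have "(\<Prod>e\<in>insert e A. g e True + (real q - 1) * g e False)
        = (g e True + (real q - 1) * g e False) * (\<Prod>e\<in>A. g e True + (real q - 1) * g e False)"
      using insert.hyps by simp
    moreover have "t * n = v * r"
      if "t * x = s * y" "s * m = v * w" "n = x * m" "r = y * w" for t n v r x s y m w :: real
      using that by algebra
    ultimately show ?case by blast
  qed
  with \<open>finite E\<close> show ?thesis by blast
qed

lemma compatible_colourings_iff_monochromatic:
  assumes "simple_graph V E" "A \<subseteq> E"
  shows "\<sigma> \<in> compatible_colourings V q A \<longleftrightarrow>
    \<sigma> \<in> colourings V q \<and> (\<forall>e\<in>A. monochromatic e \<sigma>)"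
proof -
  have "monochromatic e \<sigma>" if "e \<in> A" "\<forall>u v. {u, v} \<in> A \<longrightarrow> \<sigma> u = \<sigma> v" for e
    using that assms simple_graph_edgeE[of V E e] by (metis monochromatic_insert subsetD)
  then show ?thesis by (auto simp: compatible_colourings_def)
qed

lemma equiv_connected_rel: "equiv V (connected_rel V A)"
  by (rule equivI)
    (auto simp: connected_rel_def refl_on_def sym_def intro!: transI
      dest: rtrancl_adjacent_sym)

lemma compatible_colouring_connected:
  assumes "\<sigma> \<in> compatible_colourings V q A" "(u, v) \<in> (adjacent A)\<^sup>*"
  shows "\<sigma> u = \<sigma> v"
  using assms(2) by induction (use assms(1) in \<open>auto simp: compatible_colourings_def\<close>)

lemma card_compatible_colourings:
  assumes "simple_graph V A"
  shows "card (compatible_colourings V q A) = q ^ num_components V A"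
proof -
  let ?R = "connected_rel V A"
  have finV: "finite V" using assms by (simp add: simple_graph_def)
  have fin: "finite (V // ?R)"
    by (rule finite_quotient[OF finV]) (auto simp: connected_rel_def)
  define lift :: "('a set \<Rightarrow> nat) \<Rightarrow> 'a \<Rightarrow> nat" where "lift F = (\<lambda>v\<in>V. F (?R `` {v}))" for F
  have "bij_betw lift (V // ?R \<rightarrow>\<^sub>E {1..q}) (compatible_colourings V q A)"
  proof (rule bij_betwI')
    fix F G assume FG: "F \<in> V // ?R \<rightarrow>\<^sub>E {1..q}" "G \<in> V // ?R \<rightarrow>\<^sub>E {1..q}"
    show "lift F = lift G \<longleftrightarrow> F = G"
    proof
      assume eq: "lift F = lift G"
      show "F = G"
      proof (rule PiE_ext[OF FG])
        fix X assume "X \<in> V // ?R"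
        then obtain v where "v \<in> V" "X = ?R `` {v}" by (auto elim: quotientE)
        then show "F X = G X" using fun_cong[OF eq, of v] by (simp add: lift_def)
      qed
    qed simp
  next
    fix F assume F: "F \<in> V // ?R \<rightarrow>\<^sub>E {1..q}"
    have "lift F u = lift F v" if "{u, v} \<in> A" for u v
    proof -
      have "u \<in> V" "v \<in> V" using that assms by (auto simp: simple_graph_def)
      with that have "(u, v) \<in> ?R" by (auto simp: connected_rel_def)
      then have "?R `` {u} = ?R `` {v}" by (rule equiv_class_eq[OF equiv_connected_rel])
      with \<open>u \<in> V\<close> \<open>v \<in> V\<close> show ?thesis by (simp add: lift_def)
    qed
    moreover have "lift F \<in> colourings V q"
      using F by (auto simp: colourings_def lift_def PiE_iff quotientI)
    ultimately show "lift F \<in> compatible_colourings V q A"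
      by (simp add: compatible_colourings_def)
  next
    fix \<sigma> assume \<sigma>: "\<sigma> \<in> compatible_colourings V q A"
    define F where "F = (\<lambda>X\<in>V // ?R. \<sigma> (SOME v. v \<in> X))"
    have some: "(SOME v. v \<in> X) \<in> X" if "X \<in> V // ?R" for X
      using in_quotient_imp_non_empty[OF equiv_connected_rel that] by (simp add: some_in_eq)
    have range: "\<sigma> v \<in> {1..q}" if "v \<in> V" for v
      using \<sigma> that by (auto simp: compatible_colourings_def colourings_def PiE_iff)
    have "F \<in> V // ?R \<rightarrow>\<^sub>E {1..q}"
      using some range in_quotient_imp_subset[OF equiv_connected_rel]
      unfolding F_def by (intro restrict_PiE_iff[THEN iffD2] ballI) blast
    moreover have "\<sigma> = lift F"
    proof
      fix v
      show "\<sigma> v = lift F v"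
      proof (cases "v \<in> V")
        case True
        then have X: "?R `` {v} \<in> V // ?R" by (rule quotientI)
        have "(v, SOME w. w \<in> ?R `` {v}) \<in> (adjacent A)\<^sup>*"
          using some[OF X] by (auto simp: connected_rel_def)
        then show ?thesis
          using True X compatible_colouring_connected[OF \<sigma>] by (simp add: lift_def F_def)
      next
        case False
        then show ?thesis
          using \<sigma> by (auto simp: lift_def compatible_colourings_def colourings_def PiE_iff
              extensional_def)
      qed
    qed
    ultimately show "\<exists>F\<in>V // ?R \<rightarrow>\<^sub>E {1..q}. \<sigma> = lift F" by blast
  qed
  then have "card (compatible_colourings V q A) = card (V // ?R \<rightarrow>\<^sub>E {1..q})"
    by (simp add: bij_betw_same_card)
  then show ?thesis using fin by (simp add: card_PiE num_components_def)
qed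

lemma prod_of_bool: "finite A \<Longrightarrow> (\<Prod>x\<in>A. of_bool (P x)) = (of_bool (\<forall>x\<in>A. P x) :: real)"
  by (induction A rule: finite_induct) auto

text \<open>The number of components is measured through the identity
  \<open>q ^ c(A) = card (\<Omega>(A))\<close>, which turns it into another colouring sum that factorises.\<close>

lemma power_num_components_forest:
  assumes graph: "simple_graph V E" and acyclic: "\<nexists>xs. is_cycle E xs" and AE: "A \<subseteq> E"
  shows "real q ^ num_components V A * real q ^ card E =
         real q ^ card V * (\<Prod>e\<in>E. if e \<in> A then 1 else real q)"
proof -
  have fin: "finite E" "finite V"
    using graph simple_graph_finite_edges by (auto simp: simple_graph_def)
  have A: "simple_graph V A" using graph AE by (auto simp: simple_graph_def)
  let ?g = "\<lambda>e m. of_bool (e \<in> A \<longrightarrow> m) :: real"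
  have "real q ^ num_components V A = real (card (compatible_colourings V q A))"
    using card_compatible_colourings[OF A] by simp
  also have "compatible_colourings V q A
      = {\<sigma> \<in> colourings V q. \<forall>e\<in>E. e \<in> A \<longrightarrow> monochromatic e \<sigma>}"
    using compatible_colourings_iff_monochromatic[OF graph AE] AE by auto
  also have "real (card \<dots>)
      = (\<Sum>\<sigma>\<in>colourings V q. of_bool (\<forall>e\<in>E. e \<in> A \<longrightarrow> monochromatic e \<sigma>))"
    using finite_colourings[OF fin(2)] by (simp add: of_bool_def sum.If_cases Int_def)
  also have "\<dots> = (\<Sum>\<sigma>\<in>colourings V q. \<Prod>e\<in>E. ?g e (monochromatic e \<sigma>))"
    using fin by (simp only: prod_of_bool)
  finally have "real q ^ num_components V A * real q ^ card E
      = real q ^ card V * (\<Prod>e\<in>E. ?g e True + (real q - 1) * ?g e False)"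
    using sum_colourings_forest[OF graph acyclic, where g = ?g and q = q] by simp
  also have "(\<Prod>e\<in>E. ?g e True + (real q - 1) * ?g e False)
      = (\<Prod>e\<in>E. if e \<in> A then 1 else real q)"
    by (rule prod.cong) auto
  finally show ?thesis .
qed

section \<open>Products of two-state chains\<close>

text \<open>The transition matrix on the states absent (\<open>False\<close>) and present (\<open>True\<close>) which moves to
  \<open>True\<close> with probability \<open>a\<close> from \<open>False\<close> and \<open>a + b\<close> from \<open>True\<close>. Its eigenvalues are \<open>1\<close>
  and \<open>b\<close>.\<close>

definition two_state :: "real \<Rightarrow> real \<Rightarrow> bool \<Rightarrow> bool \<Rightarrow> real" where
  "two_state a b x y = (if y then a + b * of_bool x else 1 - (a + b * of_bool x))"

text \<open>On a forest, the Swendsen--Wang chain is a product over the edges.\<close>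

lemma P_SW_forest:
  assumes graph: "simple_graph V E" and acyclic: "\<nexists>xs. is_cycle E xs"
    and AE: "A \<subseteq> E" and BE: "B \<subseteq> E" and p: "p < 1" and q: "q \<ge> 1"
  shows "P_SW V E p q A B = (\<Prod>e\<in>E. two_state (p / q) (p - p / q) (e \<in> A) (e \<in> B))"
proof -
  have fin: "finite E" "finite V"
    using graph simple_graph_finite_edges by (auto simp: simple_graph_def)
  let ?g = "\<lambda>e m. if m then 1 - p else of_bool (e \<notin> A \<union> B)"
  let ?b = "\<lambda>e. if e \<in> B then p / (1 - p) else 1"
  let ?d = "\<lambda>e. if e \<in> A then 1 else real q"
  have weight: "(1 - p) ^ card (mono_edges E \<sigma>) * of_bool (\<sigma> \<in> compatible_colourings V q (A \<union> B))
      = (\<Prod>e\<in>E. ?g e (monochromatic e \<sigma>))" if \<sigma>: "\<sigma> \<in> colourings V q" for \<sigma>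
  proof -
    have "(\<Prod>e\<in>E. ?g e (monochromatic e \<sigma>))
        = (\<Prod>e\<in>E. (if monochromatic e \<sigma> then 1 - p else 1) *
            of_bool (e \<in> A \<union> B \<longrightarrow> monochromatic e \<sigma>))"
      by (rule prod.cong) auto
    also have "\<dots> = (1 - p) ^ card {e \<in> E. monochromatic e \<sigma>} *
        of_bool (\<forall>e\<in>E. e \<in> A \<union> B \<longrightarrow> monochromatic e \<sigma>)"
      using fin by (simp only: prod.distrib prod_of_bool) (simp add: prod.If_cases Int_def)
    also have "(\<forall>e\<in>E. e \<in> A \<union> B \<longrightarrow> monochromatic e \<sigma>)
        \<longleftrightarrow> \<sigma> \<in> compatible_colourings V q (A \<union> B)"
      using compatible_colourings_iff_monochromatic[OF graph, of "A \<union> B"] AE BE \<sigma> by auto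
    finally show ?thesis by (simp add: mono_edges_def monochromatic_def)
  qed
  let ?S = "\<Sum>\<sigma>\<in>colourings V q. \<Prod>e\<in>E. ?g e (monochromatic e \<sigma>)"
  have b: "(p / (1 - p)) ^ card B = (\<Prod>e\<in>E. ?b e)"
    using fin BE by (simp add: prod.If_cases Int_absorb1)
  have nz: "real q ^ card E \<noteq> 0" "real q ^ card V \<noteq> 0" "(\<Prod>e\<in>E. ?d e) \<noteq> 0"
    using q fin by auto
  note c = power_num_components_forest[OF graph acyclic AE, of q]
  note s = sum_colourings_forest[OF graph acyclic, where g = ?g and q = q]
  have "inverse (real q ^ num_components V A) * ?S
      = (?S * real q ^ card E) / (real q ^ num_components V A * real q ^ card E)"
    using nz by (simp add: divide_inverse)
  also have "\<dots> = (\<Prod>e\<in>E. ?g e True + (real q - 1) * ?g e False) / (\<Prod>e\<in>E. ?d e)"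
    unfolding c s using nz(2) by (rule mult_divide_mult_cancel_left)
  finally have ratio: "inverse (real q ^ num_components V A) * ?S
      = (\<Prod>e\<in>E. ?g e True + (real q - 1) * ?g e False) / (\<Prod>e\<in>E. ?d e)" .
  have "P_SW V E p q A B = (p / (1 - p)) ^ card B * (inverse (real q ^ num_components V A) * ?S)"
    unfolding P_SW_def using weight by (simp cong: sum.cong)
  also have "\<dots> = (\<Prod>e\<in>E. ?b e * ((?g e True + (real q - 1) * ?g e False) / ?d e))"
    unfolding ratio b by (simp only: prod.distrib prod_dividef)
  also have "\<dots> = (\<Prod>e\<in>E. two_state (p / q) (p - p / q) (e \<in> A) (e \<in> B))"
    using p q by (intro prod.cong refl) (auto simp: two_state_def field_simps)
  finally show ?thesis .
qed

lemma sum_Pow_prod: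
  fixes h :: "'e \<Rightarrow> bool \<Rightarrow> 'a :: comm_semiring_1"
  assumes "finite E"
  shows "(\<Sum>B\<in>Pow E. \<Prod>e\<in>E. h e (e \<in> B)) = (\<Prod>e\<in>E. h e True + h e False)"
proof -
  have "(\<Prod>e\<in>E. h e (e \<in> B)) = (\<Prod>e\<in>B. h e True) * (\<Prod>e\<in>E - B. h e False)"
    if "B \<subseteq> E" for B
    using that assms by (subst prod.subset_diff[OF that assms]) (simp add: mult.commute)
  then show ?thesis unfolding prod_add[OF assms] by (intro sum.cong) auto
qed

text \<open>The left and right eigenvectors of the two-state chain, where \<open>c\<close> is the stationary
  probability of \<open>True\<close>. The index \<open>False\<close> refers to the eigenvalue \<open>1\<close>, the index \<open>True\<close> to
  the other one.\<close>

definition left_ev :: "real \<Rightarrow> bool \<Rightarrow> bool \<Rightarrow> real" where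
  "left_ev c s x = (if s then (if x then 1 else -1) else (if x then c else 1 - c))"

definition right_ev :: "real \<Rightarrow> bool \<Rightarrow> bool \<Rightarrow> real" where
  "right_ev c s x = (if s then of_bool x - c else 1)"

text \<open>In what follows \<open>P\<close> is a product of copies of the two-state chain, one for each element of
  \<open>E\<close>; a state is the set of elements that are present.\<close>

context
  fixes E :: "'e set" and a b c :: real and P :: "'e set \<Rightarrow> 'e set \<Rightarrow> real"
  assumes finE: "finite E" and b1: "b \<noteq> 1" and c: "c = a / (1 - b)"
    and P: "\<And>A B. A \<subseteq> E \<Longrightarrow> B \<subseteq> E \<Longrightarrow> P A B = (\<Prod>e\<in>E. two_state a b (e \<in> A) (e \<in> B))"
begin

lemma stationary: "a + b * c = c"
  using b1 unfolding c by (simp add: field_simps)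

lemma prod_eigenvalue:
  assumes "S \<subseteq> E"
  shows "(\<Prod>e\<in>E. if e \<in> S then b else 1) = b ^ card S"
  using assms finE by (simp add: prod.If_cases Int_absorb1)

lemma left_eigenvector_product:
  assumes "S \<subseteq> E" "B \<subseteq> E"
  shows "(\<Sum>A\<in>Pow E. (\<Prod>e\<in>E. left_ev c (e \<in> S) (e \<in> A)) * P A B)
       = b ^ card S * (\<Prod>e\<in>E. left_ev c (e \<in> S) (e \<in> B))"
proof -
  have "(\<Sum>A\<in>Pow E. (\<Prod>e\<in>E. left_ev c (e \<in> S) (e \<in> A)) * P A B)
      = (\<Sum>A\<in>Pow E. \<Prod>e\<in>E. left_ev c (e \<in> S) (e \<in> A) * two_state a b (e \<in> A) (e \<in> B))"
    using assms by (intro sum.cong) (auto simp: P prod.distrib)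
  also have "\<dots> = (\<Prod>e\<in>E. left_ev c (e \<in> S) True * two_state a b True (e \<in> B) +
                    left_ev c (e \<in> S) False * two_state a b False (e \<in> B))"
    by (rule sum_Pow_prod[OF finE])
  also have "\<dots> = (\<Prod>e\<in>E. (if e \<in> S then b else 1) * left_ev c (e \<in> S) (e \<in> B))"
    using stationary
    by (intro prod.cong refl) (auto simp: left_ev_def two_state_def algebra_simps)
  finally show ?thesis by (simp add: prod.distrib prod_eigenvalue[OF assms(1)])
qed

lemma right_eigenvector_product:
  assumes "S \<subseteq> E" "A \<subseteq> E"
  shows "(\<Sum>B\<in>Pow E. P A B * (\<Prod>e\<in>E. right_ev c (e \<in> S) (e \<in> B)))
       = b ^ card S * (\<Prod>e\<in>E. right_ev c (e \<in> S) (e \<in> A))"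
proof -
  have "(\<Sum>B\<in>Pow E. P A B * (\<Prod>e\<in>E. right_ev c (e \<in> S) (e \<in> B)))
      = (\<Sum>B\<in>Pow E. \<Prod>e\<in>E. two_state a b (e \<in> A) (e \<in> B) * right_ev c (e \<in> S) (e \<in> B))"
    using assms by (intro sum.cong) (auto simp: P prod.distrib)
  also have "\<dots> = (\<Prod>e\<in>E. two_state a b (e \<in> A) True * right_ev c (e \<in> S) True +
                    two_state a b (e \<in> A) False * right_ev c (e \<in> S) False)"
    by (rule sum_Pow_prod[OF finE])
  also have "\<dots> = (\<Prod>e\<in>E. (if e \<in> S then b else 1) * right_ev c (e \<in> S) (e \<in> A))"
    using stationary
    by (intro prod.cong refl) (auto simp: right_ev_def two_state_def algebra_simps)
  finally show ?thesis by (simp add: prod.distrib prod_eigenvalue[OF assms(1)])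
qed

text \<open>The left eigenvectors span: every unit vector is a combination of them, with the right
  eigenvectors as coefficients.\<close>

lemma left_eigenvectors_complete:
  assumes "A \<subseteq> E" "B \<subseteq> E"
  shows "(\<Sum>S\<in>Pow E. (\<Prod>e\<in>E. right_ev c (e \<in> S) (e \<in> A)) * (\<Prod>e\<in>E. left_ev c (e \<in> S) (e \<in> B)))
       = of_bool (A = B)"
proof -
  have "(\<Sum>S\<in>Pow E. (\<Prod>e\<in>E. right_ev c (e \<in> S) (e \<in> A)) * (\<Prod>e\<in>E. left_ev c (e \<in> S) (e \<in> B)))
      = (\<Prod>e\<in>E. right_ev c True (e \<in> A) * left_ev c True (e \<in> B) +
               right_ev c False (e \<in> A) * left_ev c False (e \<in> B))"
    using sum_Pow_prod[OF finE, of "\<lambda>e s. right_ev c s (e \<in> A) * left_ev c s (e \<in> B)"]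
    by (simp add: prod.distrib)
  also have "\<dots> = (\<Prod>e\<in>E. of_bool (e \<in> A \<longleftrightarrow> e \<in> B))"
    by (intro prod.cong refl) (auto simp: right_ev_def left_ev_def)
  also have "\<dots> = of_bool (A = B)"
    using assms by (subst prod_of_bool[OF finE]) (auto intro!: arg_cong[of _ _ of_bool])
  finally show ?thesis .
qed

text \<open>Pairing an eigenfunction with a left eigenvector whose eigenvalue is different gives zero,
  and by completeness the pairings cannot all vanish.\<close>

lemma eigenvalue_product:
  assumes "eigenvalue_on (Pow E) P \<xi>"
  shows "\<exists>S\<subseteq>E. \<xi> = of_real (b ^ card S)"
proof (rule ccontr)
  assume no: "\<not> ?thesis"
  define L where "L S A = (\<Prod>e\<in>E. left_ev c (e \<in> S) (e \<in> A))" for S A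
  define R where "R S A = (\<Prod>e\<in>E. right_ev c (e \<in> S) (e \<in> A))" for S A
  from assms obtain f A where A: "A \<in> Pow E" "f A \<noteq> 0"
    and f: "\<And>x. x \<in> Pow E \<Longrightarrow> (\<Sum>y\<in>Pow E. complex_of_real (P x y) * f y) = \<xi> * f x"
    unfolding eigenvalue_on_def by blast
  have zero: "(\<Sum>B\<in>Pow E. complex_of_real (L S B) * f B) = 0" if S: "S \<subseteq> E" for S
  proof -
    have "\<xi> * (\<Sum>x\<in>Pow E. complex_of_real (L S x) * f x)
        = (\<Sum>x\<in>Pow E. complex_of_real (L S x) * (\<Sum>y\<in>Pow E. complex_of_real (P x y) * f y))"
      by (simp add: f sum_distrib_left[of \<xi>] mult.left_commute)
    also have "\<dots> = (\<Sum>y\<in>Pow E. \<Sum>x\<in>Pow E. complex_of_real (L S x * P x y) * f y)"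
      by (subst sum.swap) (simp add: sum_distrib_left mult_ac)
    also have "\<dots> = (\<Sum>y\<in>Pow E. complex_of_real (\<Sum>x\<in>Pow E. L S x * P x y) * f y)"
      by (simp add: sum_distrib_right)
    also have "\<dots> = (\<Sum>y\<in>Pow E. complex_of_real (b ^ card S * L S y) * f y)"
      using left_eigenvector_product[OF S] by (intro sum.cong refl) (simp add: L_def)
    also have "\<dots> = of_real (b ^ card S) * (\<Sum>y\<in>Pow E. complex_of_real (L S y) * f y)"
      by (simp add: sum_distrib_left mult_ac)
    finally show ?thesis using no S by auto
  qed
  have "f A = (\<Sum>B\<in>Pow E. complex_of_real (of_bool (A = B)) * f B)"
    using A finE by (subst sum.remove[of _ A]) (auto intro!: sum.neutral)
  also have "\<dots> = (\<Sum>B\<in>Pow E. complex_of_real (\<Sum>S\<in>Pow E. R S A * L S B) * f B)"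
    using left_eigenvectors_complete A by (intro sum.cong refl) (auto simp: L_def R_def)
  also have "\<dots> = (\<Sum>B\<in>Pow E. \<Sum>S\<in>Pow E. complex_of_real (R S A * L S B) * f B)"
    by (simp add: sum_distrib_right)
  also have "\<dots> = (\<Sum>S\<in>Pow E. complex_of_real (R S A) * (\<Sum>B\<in>Pow E. complex_of_real (L S B) * f B))"
    by (subst sum.swap) (simp add: sum_distrib_left mult_ac)
  also have "\<dots> = 0" using zero by (intro sum.neutral) auto
  finally show False using A by simp
qed

lemma eigenvalue_product_edge:
  assumes "E \<noteq> {}"
  shows "eigenvalue_on (Pow E) P (of_real b)"
proof -
  obtain e0 where e0: "e0 \<in> E" using assms by blast
  define f where "f A = complex_of_real (\<Prod>e\<in>E. right_ev c (e \<in> {e0}) (e \<in> A))" for A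
  have f: "f A = complex_of_real (of_bool (e0 \<in> A) - c)" for A
    unfolding f_def using e0 finE by (subst prod.remove[of _ e0]) (auto simp: right_ev_def)
  \<comment> \<open>The eigenfunction takes the values \<open>- c\<close> and \<open>1 - c\<close>, which are not both zero.\<close>
  have "f {} - f {e0} = -1" by (simp add: f)
  then have "f {} \<noteq> 0 \<or> f {e0} \<noteq> 0" by auto
  then have "\<exists>x\<in>Pow E. f x \<noteq> 0" using e0 by auto
  moreover have "(\<Sum>y\<in>Pow E. complex_of_real (P x y) * f y) = of_real b * f x"
    if "x \<in> Pow E" for x
  proof -
    have "(\<Sum>y\<in>Pow E. complex_of_real (P x y) * f y)
        = complex_of_real (\<Sum>y\<in>Pow E. P x y * (\<Prod>e\<in>E. right_ev c (e \<in> {e0}) (e \<in> y)))"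
      by (simp add: f_def)
    also have "\<dots> = of_real b * f x"
      using right_eigenvector_product[of "{e0}" x] e0 that by (simp add: f_def)
    finally show ?thesis .
  qed
  ultimately show ?thesis unfolding eigenvalue_on_def by blast
qed

lemma spectral_gap_product:
  assumes "E \<noteq> {}" "0 \<le> b" "b < 1"
  shows "spectral_gap (Pow E) P = 1 - b"
proof -
  let ?M = "{cmod \<xi> | \<xi>. eigenvalue_on (Pow E) P \<xi> \<and> \<xi> \<noteq> 1}"
  have power: "\<exists>k\<le>card E. k \<noteq> 0 \<and> y = b ^ k" if y: "y \<in> ?M" for y
  proof -
    obtain \<xi> where \<xi>: "y = cmod \<xi>" "eigenvalue_on (Pow E) P \<xi>" "\<xi> \<noteq> 1" using y by blast
    obtain S where S: "S \<subseteq> E" "\<xi> = of_real (b ^ card S)"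
      using eigenvalue_product[OF \<xi>(2)] by blast
    have "card S \<noteq> 0" using S \<xi>(3) by (intro notI) simp
    moreover have "y = b ^ card S" using S \<xi>(1) assms(2) by (simp add: norm_power)
    ultimately show ?thesis using card_mono[OF finE S(1)] by blast
  qed
  then have "?M \<subseteq> (\<lambda>k. b ^ k) ` {..card E}" by blast
  then have "finite ?M" by (rule finite_subset) simp
  moreover have "y \<le> b" if y: "y \<in> ?M" for y
  proof -
    obtain k where "k \<noteq> 0" "y = b ^ k" using power[OF y] by blast
    then show ?thesis
      using power_decreasing[of 1 k b] assms by simp
  qed
  moreover have "b \<in> ?M"
    using eigenvalue_product_edge[OF assms(1)] b1 assms(2)
    by (intro CollectI exI[of _ "complex_of_real b"]) auto
  ultimately have "Max ?M = b" by (intro Max_eqI) auto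
  then show ?thesis by (simp add: spectral_gap_def)
qed

end

section \<open>The spectral gap on a tree\<close>

theorem corollary7:
  fixes V :: "'v set" and E :: "'v set set" and p :: real and q :: nat
  assumes "finite_tree V E" and "E \<noteq> {}"
    and "0 < p" and "p < 1" and "q \<ge> 1"
  shows "0 < spectral_gap (Pow E) (P_SW V E p q) \<and>
    inverse (spectral_gap (Pow E) (P_SW V E p q))
      \<le> 2 * inverse (1 - p * (1 - inverse (real q))) * real (card E)"
proof -
  have graph: "simple_graph V E" and acyclic: "\<nexists>xs. is_cycle E xs"
    using assms(1) by (auto simp: finite_tree_def)
  have finE: "finite E" using graph by (rule simple_graph_finite_edges)
  define b where "b = p - p / real q"
  have b: "b = p * (1 - inverse (real q))" by (simp add: b_def divide_inverse right_diff_distrib)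
  have "0 \<le> p / real q" "p / real q \<le> p"
    using assms by (auto simp: field_simps)
  then have b01: "0 \<le> b" "b < 1" using assms unfolding b_def by linarith+
  have "spectral_gap (Pow E) (P_SW V E p q) = 1 - b"
    by (rule spectral_gap_product[OF finE _ refl, where a = "p / q"])
      (use P_SW_forest[OF graph acyclic] assms b01 in \<open>auto simp: b_def\<close>)
  moreover have "inverse (1 - b) * 1 \<le> inverse (1 - b) * (2 * real (card E))"
  proof (rule mult_left_mono)
    have "card E \<ge> 1" using assms(2) finE by (simp add: Suc_le_eq card_gt_0_iff)
    then show "1 \<le> 2 * real (card E)" by simp
  qed (use b01 in simp)
  ultimately show ?thesis using b01 unfolding b[symmetric] by (simp add: mult_ac)
qed

end
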